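(* Let $K \in \mathcal{B}(\mathcal{H}_n)$ be a positive semi-definite operator. Then $\tilde{r}_{1}=\dfrac{\operatorname{tr}(K)}{N}$. Moreover, an $(N,n)$ $K$-dual pair $(F,G)$ belongs to $\mathcal{R}_{1}$ if and only if it is a $1$-uniform $K$-dual pair.
   Context: $\mathcal{H}_n$ is an $n$-dimensional Hilbert space (over $\mathbb{R}$ or $\mathbb{C}$), $\mathcal{B}(\mathcal{H}_n)$ is the algebra of bounded linear operators on it, and $N\ge n$ is a fixed integer. For $K\in\mathcal{B}(\mathcal{H}_n)$, a sequence $F=\{f_i\}_{i=1}^N\subset\mathcal{H}_n$ is a $K$-frame if there are constants $0<A\le B<\infty$ with $A\|K^*f\|^2\le\sum_{i=1}^N|\langle f,f_i\rangle|^2\le B\|f\|^2$ for all $f\in\mathcal{H}_n$. A sequence $G=\{g_i\}_{i=1}^N\subset\mathcal{H}_n$ is a $K$-dual of the $K$-frame $F$ if $Kf=\sum_{i=1}^N\langle f,g_i\rangle f_i$ for all $f\in\mathcal{H}_n$ (equivalently $K^*f=\sum_{i=1}^N\langle f,f_i\rangle g_i$ for all $f$). In this case $(F,G)$ is called an $(N,n)$ $K$-dual pair for $\mathcal{H}_n$. For a $K$-dual pair $(F,G)$, $r_1(F,G)$ is the maximum over $1\le i\le N$ of the spectral radius of the error operator $f\mapsto\langle f,f_i\rangle g_i$, i.e. $r_1(F,G)=\max_{1\le i\le N}|\langle f_i,g_i\rangle|$. Set $\tilde r_1:=\inf\{r_1(F,G):(F,G)\text{ is an }(N,n)\ K\text{-dual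 pair for }\mathcal{H}_n\}$ and $\mathcal{R}_1:=\{(F,G): (F,G)\text{ is an }(N,n)\ K\text{-dual pair with } r_1(F,G)=\tilde r_1\}$. A $K$-dual pair $(F,G)$ is $1$-uniform if there is a constant $c\in\mathbb{C}$ with $\langle f_i,g_i\rangle=c$ for all $1\le i\le N$. *)

theory Defs
  imports "HOL-Analysis.Analysis"
begin

text \<open>
  A common treatment of the scalar fields \<open>\<real>\<close> and \<open>\<complex>\<close>. The lemma \<open>rc_scalar_cases\<close> below shows
  that a field of this class is either the reals or a copy of the complex numbers, with
  \<open>rc_cnj\<close> the identity or the usual conjugation, respectively.
\<close>

class rc_scalar = real_normed_field +
  fixes rc_cnj :: "'a \<Rightarrow> 'a"
  assumes rc_cnj_add: "rc_cnj (x + y) = rc_cnj x + rc_cnj y"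
    and mult_rc_cnj_scaleR: "x * rc_cnj x = ((norm x)\<^sup>2) *\<^sub>R 1"

lemma mult_rc_cnj: "x * rc_cnj x = of_real ((norm x)\<^sup>2)" for x :: "'k :: rc_scalar"
  by (simp only: mult_rc_cnj_scaleR of_real_def)

instantiation real :: rc_scalar
begin
definition "rc_cnj (x :: real) = x"
instance by standard (simp_all add: rc_cnj_real_def power2_eq_square)
end

instantiation complex :: rc_scalar
begin
definition "rc_cnj (x :: complex) = cnj x"
instance by standard
    (simp_all only: rc_cnj_complex_def complex_norm_square complex_cnj_add flip: of_real_def)
end

lemma rc_cnj_0 [simp]: "rc_cnj (0 :: 'k :: rc_scalar) = 0"
  using rc_cnj_add[of "0::'k" 0] by simp

lemma rc_cnj_minus: "rc_cnj (- x) = - rc_cnj (x :: 'k :: rc_scalar)"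
  using rc_cnj_add[of x "- x"] by (simp add: eq_neg_iff_add_eq_0 add.commute)

lemma rc_cnj_eq: "(x :: 'k :: rc_scalar) \<noteq> 0 \<Longrightarrow> rc_cnj x = of_real ((norm x)\<^sup>2) / x"
  using mult_rc_cnj[of x] by (simp add: field_simps)

lemma rc_cnj_mult: "rc_cnj (x * y) = rc_cnj x * rc_cnj (y :: 'k :: rc_scalar)"
  by (cases "x = 0 \<or> y = 0") (auto simp: rc_cnj_eq norm_mult power_mult_distrib)

lemma rc_cnj_of_real [simp]: "rc_cnj (of_real r :: 'k :: rc_scalar) = of_real r"
  by (cases "r = 0") (simp_all add: rc_cnj_eq power2_eq_square)

lemma rc_cnj_rc_cnj [simp]: "rc_cnj (rc_cnj x) = (x :: 'k :: rc_scalar)"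
proof (cases "x = 0")
  case False
  have "rc_cnj x * rc_cnj (rc_cnj x) = rc_cnj (x * rc_cnj x)"
    by (simp only: rc_cnj_mult)
  also have "\<dots> = x * rc_cnj x"
    by (simp only: mult_rc_cnj rc_cnj_of_real)
  finally have "rc_cnj x * rc_cnj (rc_cnj x) = rc_cnj x * x"
    by (simp only: mult.commute)
  moreover have "rc_cnj x \<noteq> 0"
    using False mult_rc_cnj[of x] by auto
  ultimately show ?thesis by simp
qed simp

lemma add_rc_cnj_Reals: "x + rc_cnj x \<in> \<real>" for x :: "'k :: rc_scalar"
proof -
  have "(1 + x) * rc_cnj (1 + x) = 1 + (x + rc_cnj x) + x * rc_cnj x"
    using rc_cnj_of_real[of 1, where 'k = 'k] by (simp add: rc_cnj_add algebra_simps)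
  then have "x + rc_cnj x = of_real ((norm (1 + x))\<^sup>2 - 1 - (norm x)\<^sup>2)"
    by (simp add: mult_rc_cnj algebra_simps)
  then show ?thesis by simp
qed

lemma rc_cnj_eq_self:
  fixes x :: "'k :: rc_scalar"
  assumes "rc_cnj x = x"
  shows "x \<in> \<real>"
proof -
  have "(x + rc_cnj x) / 2 = x" unfolding assms by simp
  moreover have "(x + rc_cnj x) / 2 \<in> \<real>"
    by (rule Reals_divide[OF add_rc_cnj_Reals Reals_numeral])
  ultimately show ?thesis by (simp only:)
qed

lemma rc_scalar_cases:
  "(\<forall>z :: 'k :: rc_scalar. z \<in> \<real> \<and> rc_cnj z = z) \<or>
   (\<exists>j :: 'k. j * j = - 1 \<and> rc_cnj j = - j \<and> (\<forall>z. \<exists>a b. z = of_real a + of_real b * j))"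
proof (cases "\<forall>z :: 'k. rc_cnj z = z")
  case True
  then show ?thesis by (simp add: rc_cnj_eq_self)
next
  case False
  then obtain z :: 'k where z: "rc_cnj z \<noteq> z" by blast
  define w where "w = z - rc_cnj z"
  define j where "j = w / of_real (norm w)"
  have w0: "w \<noteq> 0" using z by (simp add: w_def)
  have cw: "rc_cnj w = - w"
    using rc_cnj_add[of z "- rc_cnj z"] by (simp add: w_def rc_cnj_minus)
  have jw: "j = of_real (inverse (norm w)) * w" by (simp add: j_def field_simps)
  have cj: "rc_cnj j = - j"
    unfolding jw by (simp only: rc_cnj_mult rc_cnj_of_real cw) simp
  have "norm j = 1" using w0 by (simp add: j_def norm_divide)
  then have jj: "j * j = - 1"
    using mult_rc_cnj[of j] cj by (simp add: neg_eq_iff_add_eq_0 eq_neg_iff_add_eq_0)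
  have ex: "\<exists>a b. x = of_real a + of_real b * j" for x
  proof -
    define u where "u = - ((x - rc_cnj x) * j)"
    have cd: "rc_cnj (x - rc_cnj x) = - (x - rc_cnj x)"
      using rc_cnj_add[of x "- rc_cnj x"] by (simp add: rc_cnj_minus)
    have "rc_cnj u = u"
      by (simp only: u_def rc_cnj_minus rc_cnj_mult cd cj minus_mult_minus)
    then have "u \<in> \<real>" by (rule rc_cnj_eq_self)
    then obtain b where b: "u = of_real b" by (rule Reals_cases)
    obtain a where a: "x + rc_cnj x = of_real a" using add_rc_cnj_Reals[of x] by (rule Reals_cases)
    have "u * j = x - rc_cnj x" using jj by (simp add: u_def mult.assoc)
    then have "(x + rc_cnj x) + u * j = 2 * x" by (simp only: mult_2) simp
    then have "2 * x = of_real a + of_real b * j" by (simp only: a b)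
    then have "x = (of_real a + of_real b * j) / 2" by (simp add: eq_divide_eq mult.commute)
    then have "x = of_real (a/2) + of_real (b/2) * j" by (simp add: add_divide_distrib)
    then show ?thesis by (intro exI)
  qed
  show ?thesis
    by (rule disjI2, rule exI[of _ j], rule conjI, rule jj, rule conjI, rule cj, rule allI, rule ex)
qed


text \<open>
  The inner product is linear in its first argument. Finite dimension makes completeness and
  the boundedness of linear operators automatic.
\<close>

locale fd_hilbert = vector_space scale
  for scale :: "'k :: rc_scalar \<Rightarrow> 'v :: ab_group_add \<Rightarrow> 'v" (infixr \<open>\<odot>\<close> 75) +
  fixes ip :: "'v \<Rightarrow> 'v \<Rightarrow> 'k"
  assumes finite_dim: "\<exists>B. finite B \<and> span B = UNIV"
    and ip_add_left: "ip (x + y) z = ip x z + ip y z"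
    and ip_scale_left: "ip (a \<odot> x) z = a * ip x z"
    and ip_cnj: "ip y x = rc_cnj (ip x y)"
    and ip_nonneg: "ip x x \<in> \<real>\<^sub>\<ge>\<^sub>0"
    and ip_eq_0_iff: "ip x x = 0 \<longleftrightarrow> x = 0"
begin

definition hnorm :: "'v \<Rightarrow> real" where
  "hnorm x = sqrt (norm (ip x x))"

definition adj :: "('v \<Rightarrow> 'v) \<Rightarrow> 'v \<Rightarrow> 'v" where
  "adj T = (THE S. \<forall>x y. ip (T x) y = ip x (S y))"

definition positive_semidefinite :: "('v \<Rightarrow> 'v) \<Rightarrow> bool" where
  "positive_semidefinite T \<longleftrightarrow> adj T = T \<and> (\<forall>x. ip (T x) x \<in> \<real>\<^sub>\<ge>\<^sub>0)"

definition op_trace :: "('v \<Rightarrow> 'v) \<Rightarrow> 'k" where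
  "op_trace T =
    (let B = (SOME B. independent B \<and> span B = UNIV) in \<Sum>b\<in>B. representation B (T b) b)"

definition op_spectrum :: "('v \<Rightarrow> 'v) \<Rightarrow> 'k set" where
  "op_spectrum T = {l. \<not> bij (\<lambda>x. T x - l \<odot> x)}"

text \<open>
  Adding 0 only matters if the spectrum is empty, e.g. on the zero space. Over the reals the
  spectrum contains only the real eigenvalues; this suffices here, as the spectral radius is only
  used for operators of rank at most one.
\<close>

definition spectral_radius :: "('v \<Rightarrow> 'v) \<Rightarrow> real" where
  "spectral_radius T = Sup (insert 0 (norm ` op_spectrum T))"

text \<open>Sequences of length \<open>N\<close> are functions on \<open>nat\<close>, of which only the values on \<open>{1..N}\<close> matter.\<close>

definition K_frame :: "nat \<Rightarrow> ('v \<Rightarrow> 'v) \<Rightarrow> (nat \<Rightarrow> 'v) \<Rightarrow> bool" where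
  "K_frame N K F \<longleftrightarrow> (\<exists>A B. 0 < A \<and> A \<le> B \<and>
     (\<forall>x. A * (hnorm (adj K x))\<^sup>2 \<le> (\<Sum>i=1..N. (norm (ip x (F i)))\<^sup>2) \<and>
          (\<Sum>i=1..N. (norm (ip x (F i)))\<^sup>2) \<le> B * (hnorm x)\<^sup>2))"

definition K_dual_pair :: "nat \<Rightarrow> ('v \<Rightarrow> 'v) \<Rightarrow> (nat \<Rightarrow> 'v) \<Rightarrow> (nat \<Rightarrow> 'v) \<Rightarrow> bool" where
  "K_dual_pair N K F G \<longleftrightarrow>
     K_frame N K F \<and> (\<forall>x. K x = (\<Sum>i=1..N. ip x (G i) \<odot> F i))"

definition error_op :: "(nat \<Rightarrow> 'v) \<Rightarrow> (nat \<Rightarrow> 'v) \<Rightarrow> nat \<Rightarrow> 'v \<Rightarrow> 'v" where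
  "error_op F G i x = ip x (F i) \<odot> G i"

definition r1 :: "nat \<Rightarrow> (nat \<Rightarrow> 'v) \<Rightarrow> (nat \<Rightarrow> 'v) \<Rightarrow> real" where
  "r1 N F G = Max ((\<lambda>i. spectral_radius (error_op F G i)) ` {1..N})"

definition r1_inf :: "nat \<Rightarrow> ('v \<Rightarrow> 'v) \<Rightarrow> real" where
  "r1_inf N K = Inf {r1 N F G |F G. K_dual_pair N K F G}"

definition R1_set :: "nat \<Rightarrow> ('v \<Rightarrow> 'v) \<Rightarrow> ((nat \<Rightarrow> 'v) \<times> (nat \<Rightarrow> 'v)) set" where
  "R1_set N K = {(F, G). K_dual_pair N K F G \<and> r1 N F G = r1_inf N K}"

definition one_uniform :: "nat \<Rightarrow> ('v \<Rightarrow> 'v) \<Rightarrow> (nat \<Rightarrow> 'v) \<Rightarrow> (nat \<Rightarrow> 'v) \<Rightarrow> bool" where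
  "one_uniform N K F G \<longleftrightarrow>
     K_dual_pair N K F G \<and> (\<exists>c. \<forall>i\<in>{1..N}. ip (F i) (G i) = c)"

lemma spectral_radius_error_op: "spectral_radius (error_op F G i) = norm (ip (F i) (G i))"
proof -
  define f g c where "f = F i" and "g = G i" and "c = ip g f"
  let ?S = "op_spectrum (error_op F G i)"
  have E: "error_op F G i x = ip x f \<odot> g" for x
    by (simp add: error_op_def f_def g_def)
  have norm_c: "norm c = norm (ip f g)"
  proof -
    have "norm (rc_cnj x) = norm (x :: 'k)" for x
      by (cases "x = 0") (simp_all add: rc_cnj_eq norm_divide power2_eq_square norm_mult)
    then show ?thesis unfolding c_def by (metis ip_cnj)
  qed
  have ip0: "ip 0 y = 0" for y using ip_add_left[of 0 0 y] by simp
  have ipm: "ip (x - y) z = ip x z - ip y z" for x y z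
    using ip_add_left[of "x - y" y z] by (simp add: algebra_simps)
  have sub: "?S \<subseteq> {0, c}"
  proof
    fix l assume l: "l \<in> ?S"
    show "l \<in> {0, c}"
    proof (rule ccontr)
      assume "l \<notin> {0, c}"
      then have l0: "l \<noteq> 0" and lc: "c - l \<noteq> 0" by auto
      define h where "h y = inverse l \<odot> ((ip y f / (c - l)) \<odot> g - y)" for y
      have 1: "ip (h y) f \<odot> g - l \<odot> h y = y" for y
      proof -
        have "ip (h y) f = inverse l * (ip y f / (c - l) * c - ip y f)"
          by (simp add: h_def ip_scale_left ipm c_def)
        also have "\<dots> = ip y f / (c - l)" using l0 lc by (simp add: field_simps)
        finally show ?thesis using l0 by (simp add: h_def)
      qed
      have 2: "h (ip x f \<odot> g - l \<odot> x) = x" for x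
      proof -
        have "ip (ip x f \<odot> g - l \<odot> x) f = ip x f * (c - l)"
          by (simp add: ip_scale_left ipm c_def algebra_simps)
        then show ?thesis using l0 lc by (simp add: h_def)
      qed
      have "bij (\<lambda>x. ip x f \<odot> g - l \<odot> x)"
        by (rule o_bij[of h]) (auto simp: 1 2)
      then show False using l by (simp add: op_spectrum_def E)
    qed
  qed
  have c: "c \<in> ?S" if "c \<noteq> 0"
  proof -
    have "g \<noteq> 0" using that ip0 by (auto simp: c_def)
    moreover have "ip g f \<odot> g - c \<odot> g = 0" "ip 0 f \<odot> g - c \<odot> 0 = 0"
      by (simp_all add: c_def ip0)
    ultimately have "\<not> inj (\<lambda>x. ip x f \<odot> g - c \<odot> x)"
      using injD[of "\<lambda>x. ip x f \<odot> g - c \<odot> x" g 0] by auto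
    then show ?thesis by (simp add: op_spectrum_def E bij_def)
  qed
  have "insert 0 (norm ` ?S) = {0, norm c}"
    using sub c by (cases "c = 0") auto
  then show ?thesis
    unfolding spectral_radius_def using norm_c by (simp add: f_def g_def cSup_eq_Max)
qed

lemma r1_eq: "r1 N F G = Max ((\<lambda>i. norm (ip (F i) (G i))) ` {1..N})"
  by (simp add: r1_def spectral_radius_error_op)

end

lemma fd_hilbert_euclidean: "fd_hilbert ((*\<^sub>R) :: real \<Rightarrow> 'a \<Rightarrow> 'a :: euclidean_space) (\<bullet>)"
proof (unfold_locales, goal_cases)
  case 1
  show ?case using span_Basis finite_Basis unfolding span_raw_def by blast
next
  case (2 x y z)
  show ?case by (rule inner_add_left)
next
  case (3 a x z)
  show ?case by (rule inner_scaleR_left)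
next
  case (4 y x)
  show ?case unfolding rc_cnj_real_def by (rule inner_commute)
next
  case (5 x)
  show ?case using nonneg_Reals_of_real_iff[of "x \<bullet> x", where 'a = real] inner_ge_zero[of x] by simp
next
  case (6 x)
  show ?case by (rule inner_eq_zero_iff)
qed

lemma fd_hilbert_complex_vec:
  "fd_hilbert ((*s) :: complex \<Rightarrow> complex ^ 'n \<Rightarrow> complex ^ 'n) (\<lambda>x y. \<Sum>i\<in>UNIV. x $ i * cnj (y $ i))"
proof -
  have sq: "(\<Sum>i\<in>UNIV. x $ i * cnj (x $ i)) = of_real (\<Sum>i\<in>UNIV. (cmod (x $ i))\<^sup>2)"
    for x :: "complex ^ 'n"
    by (simp only: of_real_sum complex_norm_square)
  show ?thesis
  proof (unfold_locales, goal_cases)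
    case 1
    show ?case using vec.finite_Basis vec.span_Basis by blast
  next
    case (2 x y z)
    show ?case by (simp add: distrib_right sum.distrib)
  next
    case (3 a x z)
    show ?case by (simp add: sum_distrib_left mult.assoc)
  next
    case (4 y x)
    show ?case by (simp add: rc_cnj_complex_def mult.commute)
  next
    case (5 x)
    show ?case unfolding sq nonneg_Reals_of_real_iff by (simp add: sum_nonneg)
  next
    case (6 x)
    show ?case unfolding sq of_real_eq_0_iff by (simp add: sum_nonneg_eq_0_iff vec_eq_iff)
  qed
qed
end

theory Submission
  imports Defs
begin

text \<open>
  Write \<open>K\<close> as the sum of the rank-one operators \<open>x \<mapsto> \<langle>x, g\<^sub>i\<rangle> f\<^sub>i\<close>. Taking traces,
  \<open>tr K = \<Sum>\<^sub>i \<langle>f\<^sub>i, g\<^sub>i\<rangle>\<close> for every dual pair (\<open>op_trace_K_dual_pair\<close>). Since the error operators have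
  spectral radius \<open>|\<langle>f\<^sub>i, g\<^sub>i\<rangle>|\<close>, the triangle inequality gives \<open>|tr K| \<le> N r\<^sub>1(F, G)\<close>, and \<open>tr K \<ge> 0\<close>
  as \<open>K\<close> is positive semidefinite. If equality holds, \<open>N\<close> scalars of modulus at most \<open>s = tr K / N\<close>
  have the sum \<open>N s\<close>, which forces each of them to be \<open>s\<close> (\<open>sum_extremal_imp_const\<close>). Conversely, the
  constant of a 1-uniform pair can only be \<open>s\<close>. So everything follows once a 1-uniform pair
  exists, which makes \<open>s\<close> the infimum and not just a lower bound.

  To construct one, begin with any dual pair: an orthogonal basis \<open>(e)\<close>, padded with zeros to length
  \<open>N\<close>, and the vectors \<open>K e / \<langle>e, e\<rangle>\<close> (\<open>K_dual_pair_exists\<close>). A dual pair is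
  a factorisation \<open>K = F G\<^sup>*\<close>, which is preserved when \<open>F\<close> is multiplied by an invertible matrix \<open>V\<close> and
  \<open>G\<^sup>*\<close> by its inverse; this conjugates the \<open>N \<times> N\<close> matrix \<open>G\<^sup>* F\<close>, whose diagonal entries are
  the \<open>\<langle>f\<^sub>i, g\<^sub>i\<rangle>\<close>. Whenever two diagonal entries differ, a conjugation by shears in the two indices
  gives one of them any prescribed value (\<open>two_term_levelling\<close>), so the entries can be made equal
  to \<open>s\<close> one after another (\<open>uniform_K_dual_pair\<close>). This is purely algebraic and works alike over
  both scalar fields.
\<close>

context fd_hilbert
begin

section \<open>The inner product\<close>

lemma ip_zero_left [simp]: "ip 0 y = 0"
  using ip_add_left[of 0 0 y] by simp

lemma ip_zero_right [simp]: "ip x 0 = 0"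
  using ip_cnj[of x 0] by simp

lemma ip_add_right: "ip x (y + z) = ip x y + ip x z"
  by (metis ip_cnj ip_add_left rc_cnj_add)

lemma ip_scale_right: "ip x (a \<odot> y) = rc_cnj a * ip x y"
  by (metis ip_cnj ip_scale_left rc_cnj_mult)

lemma ip_diff_left: "ip (x - y) z = ip x z - ip y z"
  using ip_add_left[of "x - y" y z] by (simp add: algebra_simps)

lemma ip_diff_right: "ip x (y - z) = ip x y - ip x z"
  using ip_add_right[of x "y - z" z] by (simp add: algebra_simps)

lemmas ip_linear_simps = ip_add_left ip_add_right ip_diff_left ip_diff_right
  ip_scale_left ip_scale_right

lemma ip_sum_left: "ip (\<Sum>i\<in>I. x i) y = (\<Sum>i\<in>I. ip (x i) y)"
  by (induction I rule: infinite_finite_induct) (simp_all add: ip_add_left)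

lemma ip_sum_right: "ip x (\<Sum>i\<in>I. y i) = (\<Sum>i\<in>I. ip x (y i))"
  by (induction I rule: infinite_finite_induct) (simp_all add: ip_add_right)

lemma ip_self: "ip x x = of_real ((hnorm x)\<^sup>2)"
proof -
  obtain r where "ip x x = of_real r" "r \<ge> 0"
    using ip_nonneg[of x] by (auto elim: nonneg_Reals_cases)
  then show ?thesis by (simp add: hnorm_def)
qed

lemma rc_cnj_ip_self [simp]: "rc_cnj (ip x x) = ip x x"
  by (metis ip_cnj)

lemma rc_cnj_inverse_ip_self [simp]: "rc_cnj (inverse (ip x x)) = inverse (ip x x)"
  by (simp only: ip_self rc_cnj_of_real flip: of_real_inverse)

lemma ip_right_ext: "(\<And>x. ip x y = ip x z) \<Longrightarrow> y = z"
  using ip_eq_0_iff[of "y - z"] by (simp add: ip_diff_right)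

lemma Cauchy_Schwarz: "(norm (ip x y))\<^sup>2 \<le> (hnorm x)\<^sup>2 * (hnorm y)\<^sup>2"
proof (cases "y = 0")
  case False
  define z where "z = ip y y \<odot> x - ip x y \<odot> y"
  have "(of_real ((hnorm z)\<^sup>2) :: 'k) = ip y y * (ip x x * ip y y - ip x y * ip y x)"
    unfolding ip_self[symmetric]
    by (simp add: z_def ip_linear_simps algebra_simps ip_cnj[of y x, symmetric])
  also have "ip x y * ip y x = of_real ((norm (ip x y))\<^sup>2)"
    by (metis ip_cnj mult_rc_cnj)
  finally have "(of_real ((hnorm z)\<^sup>2) :: 'k)
      = of_real ((hnorm y)\<^sup>2 * ((hnorm x)\<^sup>2 * (hnorm y)\<^sup>2 - (norm (ip x y))\<^sup>2))"
    by (simp only: ip_self of_real_mult of_real_diff)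
  then have eq: "(hnorm z)\<^sup>2 = (hnorm y)\<^sup>2 * ((hnorm x)\<^sup>2 * (hnorm y)\<^sup>2 - (norm (ip x y))\<^sup>2)"
    by (simp only: of_real_eq_iff)
  have "(hnorm y)\<^sup>2 > 0"
    using False ip_eq_0_iff[of y] by (simp add: hnorm_def)
  moreover have "0 \<le> (hnorm y)\<^sup>2 * ((hnorm x)\<^sup>2 * (hnorm y)\<^sup>2 - (norm (ip x y))\<^sup>2)"
    unfolding eq[symmetric] by simp
  ultimately show ?thesis by (simp add: zero_le_mult_iff)
qed simp

section \<open>Orthogonal bases and adjoints\<close>

text \<open>
  Gram--Schmidt: each new vector is replaced by its difference \<open>d\<close> from the orthogonal projection
  onto the previous span, and dropped if \<open>d = 0\<close>.
\<close>

lemma orthogonal_spanning_set: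
  assumes "finite B"
  shows "\<exists>E. finite E \<and> 0 \<notin> E \<and> (\<forall>e\<in>E. \<forall>e'\<in>E. e \<noteq> e' \<longrightarrow> ip e e' = 0) \<and> span E = span B"
  using assms
proof (induction B rule: finite_induct)
  case empty
  show ?case by (rule exI[of _ "{}"]) simp
next
  case (insert b B)
  then obtain E where E: "finite E" "0 \<notin> E"
    "\<forall>e\<in>E. \<forall>e'\<in>E. e \<noteq> e' \<longrightarrow> ip e e' = 0" "span E = span B"
    by (elim exE conjE)
  define p where "p = (\<Sum>e\<in>E. (ip b e / ip e e) \<odot> e)"
  define d where "d = b - p"
  have p: "p \<in> span E"
    unfolding p_def by (intro span_sum span_scale span_base)
  have d_orth: "ip d e = 0" if e: "e \<in> E" for e
  proof -
    have "ip p e = (\<Sum>e'\<in>E. ip b e' / ip e' e' * ip e' e)"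
      by (simp add: p_def ip_sum_left ip_scale_left)
    also have "\<dots> = (\<Sum>e'\<in>{e}. ip b e' / ip e' e' * ip e' e)"
      by (rule sum.mono_neutral_right) (use E e in auto)
    also have "\<dots> = ip b e"
      using e E(2) ip_eq_0_iff[of e] by auto
    finally show ?thesis by (simp add: d_def ip_diff_left)
  qed
  have d_orth': "ip e d = 0" if "e \<in> E" for e
    using d_orth[OF that] ip_cnj[of e d] by simp
  have "span (insert d E) = span (insert b B)"
  proof -
    have "span (insert d E) = span (insert b E)"
      using eq_span_insert_eq[of d b E] p span_neg[OF p] by (simp add: d_def)
    also have "\<dots> = span (insert b B)"
      using E(4) by (simp add: span_insert)
    finally show ?thesis .
  qed
  then have sp: "span (insert d E - {0}) = span (insert b B)"
    by (simp add: span_delete_0)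
  have "finite (insert d E - {0})" "0 \<notin> insert d E - {0}"
    using E(1) by simp_all
  moreover have "\<forall>e\<in>insert d E - {0}. \<forall>e'\<in>insert d E - {0}. e \<noteq> e' \<longrightarrow> ip e e' = 0"
    using E(3) d_orth d_orth' by blast
  ultimately show ?case using sp by blast
qed

text \<open>
  The vectors are not normalised: then no square roots are needed, and the denominators
  \<open>\<langle>e, e\<rangle>\<close> in the expansion are harmless, being real.
\<close>

lemma orthogonal_basis:
  obtains E where "finite E" "card E = dim UNIV" "\<And>x. x = (\<Sum>e\<in>E. (ip x e / ip e e) \<odot> e)"
proof -
  obtain B where B: "finite B" "span B = UNIV" using finite_dim by blast
  obtain E where E: "finite E" "0 \<notin> E"
    "\<forall>e\<in>E. \<forall>e'\<in>E. e \<noteq> e' \<longrightarrow> ip e e' = 0" "span E = UNIV"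
    using orthogonal_spanning_set[OF B(1)] unfolding B(2) by (elim exE conjE)
  have coeff: "ip (\<Sum>e'\<in>E. c e' \<odot> e') e = c e * ip e e" if e: "e \<in> E" for c e
  proof -
    have "ip (\<Sum>e'\<in>E. c e' \<odot> e') e = (\<Sum>e'\<in>E. c e' * ip e' e)"
      by (simp add: ip_sum_left ip_scale_left)
    also have "\<dots> = (\<Sum>e'\<in>{e}. c e' * ip e' e)"
      by (rule sum.mono_neutral_right) (use E e in auto)
    finally show ?thesis by simp
  qed
  have nz: "ip e e \<noteq> 0" if "e \<in> E" for e
    using that E(2) ip_eq_0_iff by metis
  have "c e = 0" if "(\<Sum>e\<in>E. c e \<odot> e) = 0" "e \<in> E" for c e
    using coeff[OF that(2), of c] that(1) nz[OF that(2)] by simp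
  then have "independent E"
    unfolding dependent_finite[OF E(1)] by blast
  then have "card E = dim UNIV"
    using dim_eq_card[of E UNIV] E(4) by simp
  moreover have "x = (\<Sum>e\<in>E. (ip x e / ip e e) \<odot> e)" for x
  proof -
    have "x \<in> span E" using E(4) by simp
    then obtain c where x: "x = (\<Sum>e\<in>E. c e \<odot> e)"
      unfolding span_finite[OF E(1)] by blast
    have "ip x e / ip e e = c e" if "e \<in> E" for e
      unfolding x coeff[OF that] using nz[OF that] by simp
    then have "(\<Sum>e\<in>E. (ip x e / ip e e) \<odot> e) = (\<Sum>e\<in>E. c e \<odot> e)"
      by (intro sum.cong) simp_all
    then show ?thesis using x by (simp only:)
  qed
  ultimately show thesis using E(1) by (intro that)
qed

lemma adj_unique:
  assumes "\<And>x y. ip (T x) y = ip x (S y)"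
  shows "adj T = S"
  unfolding adj_def
proof (rule the_equality)
  show "\<forall>x y. ip (T x) y = ip x (S y)" using assms by simp
next
  fix S' assume "\<forall>x y. ip (T x) y = ip x (S' y)"
  then show "S' = S" using assms by (metis ext ip_right_ext)
qed

text \<open>
  As \<open>adj\<close> is a definite description, its defining property needs the existence of an adjoint, which
  is read off from the expansion in an orthogonal basis.
\<close>

lemma ip_adj:
  assumes "Vector_Spaces.linear scale scale T"
  shows "ip (T x) y = ip x (adj T y)"
proof -
  interpret T: Vector_Spaces.linear scale scale T by fact
  obtain E where E: "finite E" "\<And>x. x = (\<Sum>e\<in>E. (ip x e / ip e e) \<odot> e)"
    by (rule orthogonal_basis) (rule that)
  define S where "S y = (\<Sum>e\<in>E. (ip y (T e) / ip e e) \<odot> e)" for y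
  have "ip (T x) y = ip x (S y)" for x y
  proof -
    have cnj: "rc_cnj (ip y (T e) / ip e e) = ip (T e) y / ip e e" for e
      by (simp add: divide_inverse rc_cnj_mult flip: ip_cnj)
    have "ip (T x) y = ip (T (\<Sum>e\<in>E. (ip x e / ip e e) \<odot> e)) y"
      using E(2)[of x] by simp
    also have "\<dots> = ip x (S y)"
      by (simp add: S_def T.sum T.scale ip_sum_left ip_sum_right ip_scale_left ip_scale_right cnj)
        (simp add: mult.commute)
    finally show ?thesis .
  qed
  then show ?thesis using adj_unique[of T S] by simp
qed

section \<open>Traces of dual pairs\<close>

text \<open>
  The frame inequalities follow from the reconstruction formula. The upper one is the
  Cauchy--Schwarz inequality in each term. For the lower one, \<open>K\<^sup>* x = \<Sum>\<^sub>i \<langle>x, f\<^sub>i\<rangle> g\<^sub>i\<close>, and so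
  \<open>\<parallel>y\<parallel>\<^sup>2 = \<Sum>\<^sub>i \<langle>x, f\<^sub>i\<rangle> \<langle>g\<^sub>i, y\<rangle>\<close> for \<open>y = K\<^sup>* x\<close>, to which it applies twice.
\<close>

lemma K_dual_pair_iff: "K_dual_pair N K F G \<longleftrightarrow> (\<forall>x. K x = (\<Sum>i=1..N. ip x (G i) \<odot> F i))"
proof
  assume K: "\<forall>x. K x = (\<Sum>i=1..N. ip x (G i) \<odot> F i)"
  have adj: "adj K = (\<lambda>y. \<Sum>i=1..N. ip y (F i) \<odot> G i)"
    by (rule adj_unique)
      (simp add: K ip_sum_left ip_sum_right ip_scale_left ip_scale_right
        mult.commute flip: ip_cnj)
  \<comment> \<open>The summands 1 ensure that the frame bounds \<open>1 / C \<le> B\<close> are positive and in this order.\<close>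
  define C where "C = 1 + (\<Sum>i=1..N. (hnorm (G i))\<^sup>2)"
  define B where "B = 1 + (\<Sum>i=1..N. (hnorm (F i))\<^sup>2)"
  have C: "C \<ge> 1" and B: "B \<ge> 1"
    by (simp_all add: C_def B_def sum_nonneg)
  have lower: "(hnorm (adj K x))\<^sup>2 \<le> C * (\<Sum>i=1..N. (norm (ip x (F i)))\<^sup>2)" (is "_ \<le> C * ?s") for x
  proof -
    define y where "y = adj K x"
    have s0: "?s \<ge> 0" by (simp add: sum_nonneg)
    have "(hnorm y)\<^sup>2 = norm (ip y y)"
      by (simp add: hnorm_def)
    also have "ip y y = (\<Sum>i=1..N. ip x (F i) * ip (G i) y)"
      by (subst (1) y_def) (simp add: adj ip_sum_left ip_scale_left)
    also have "norm \<dots> \<le> (\<Sum>i=1..N. norm (ip x (F i)) * norm (ip (G i) y))"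
      by (rule order_trans[OF norm_sum]) (simp add: norm_mult)
    finally have "((hnorm y)\<^sup>2)\<^sup>2 \<le> (\<Sum>i=1..N. norm (ip x (F i)) * norm (ip (G i) y))\<^sup>2"
      by (rule power_mono) simp
    also have "\<dots> \<le> ?s * (\<Sum>i=1..N. (norm (ip (G i) y))\<^sup>2)"
      by (rule Cauchy_Schwarz_ineq_sum)
    also have "\<dots> \<le> ?s * (C * (hnorm y)\<^sup>2)"
    proof (rule mult_left_mono[OF _ s0])
      have "(\<Sum>i=1..N. (norm (ip (G i) y))\<^sup>2) \<le> (\<Sum>i=1..N. (hnorm (G i))\<^sup>2) * (hnorm y)\<^sup>2"
        unfolding sum_distrib_right by (intro sum_mono Cauchy_Schwarz)
      then show "(\<Sum>i=1..N. (norm (ip (G i) y))\<^sup>2) \<le> C * (hnorm y)\<^sup>2"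
        by (rule order_trans) (simp add: C_def distrib_right)
    qed
    finally have le: "(hnorm y)\<^sup>2 * (hnorm y)\<^sup>2 \<le> C * ?s * (hnorm y)\<^sup>2"
      by (simp add: power2_eq_square[of "(hnorm y)\<^sup>2"] algebra_simps)
    show ?thesis
    proof (cases "hnorm y = 0")
      case True
      then show ?thesis using s0 C by (simp add: y_def[symmetric])
    next
      case False
      then show ?thesis using mult_right_le_imp_le[OF le] by (simp add: y_def[symmetric])
    qed
  qed
  have upper: "(\<Sum>i=1..N. (norm (ip x (F i)))\<^sup>2) \<le> B * (hnorm x)\<^sup>2" for x
  proof -
    have "(\<Sum>i=1..N. (norm (ip x (F i)))\<^sup>2) \<le> (\<Sum>i=1..N. (hnorm (F i))\<^sup>2) * (hnorm x)\<^sup>2"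
      unfolding sum_distrib_right
      by (rule sum_mono) (use Cauchy_Schwarz in \<open>simp add: mult.commute\<close>)
    then show ?thesis by (rule order_trans) (simp add: B_def distrib_right)
  qed
  have "0 < 1 / C" "1 / C \<le> B" using B C by (simp_all add: divide_le_eq order_trans[of 1 C])
  moreover have "1 / C * (hnorm (adj K x))\<^sup>2 \<le> (\<Sum>i=1..N. (norm (ip x (F i)))\<^sup>2)" for x
    using lower[of x] C by (simp add: field_simps)
  ultimately have "K_frame N K F"
    unfolding K_frame_def using upper by blast
  then show "K_dual_pair N K F G" using K by (simp add: K_dual_pair_def)
qed (simp add: K_dual_pair_def)

text \<open>
  The operator \<open>x \<mapsto> \<langle>x, g\<rangle> f\<close> has trace \<open>\<langle>f, g\<rangle>\<close> in every basis, so it does not matter which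
  one \<open>op_trace\<close> chooses.
\<close>

lemma op_trace_K_dual_pair:
  assumes "K_dual_pair N K F G"
  shows "op_trace K = (\<Sum>i=1..N. ip (F i) (G i))"
proof -
  have K: "K x = (\<Sum>i=1..N. ip x (G i) \<odot> F i)" for x
    using assms by (simp add: K_dual_pair_iff)
  define B where "B = (SOME B. independent B \<and> span B = UNIV)"
  have "\<exists>B. independent B \<and> span B = UNIV"
    using basis_exists[of UNIV] by (metis top.extremum_unique)
  then have B: "independent B" "span B = UNIV"
    unfolding B_def by (metis (mono_tags, lifting) someI_ex)+
  obtain C where "finite C" "span C = UNIV" using finite_dim by blast
  then have finB: "finite B"
    using independent_span_bound[of C B] B by auto
  have "op_trace K = (\<Sum>b\<in>B. representation B (K b) b)"
    by (simp add: op_trace_def B_def Let_def)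
  also have "\<dots> = (\<Sum>b\<in>B. \<Sum>i=1..N. ip b (G i) * representation B (F i) b)"
    by (simp add: K representation_sum[OF B(1)] representation_scale[OF B(1)] B(2))
  also have "\<dots> = (\<Sum>i=1..N. \<Sum>b\<in>B. ip b (G i) * representation B (F i) b)"
    by (rule sum.swap)
  also have "\<dots> = (\<Sum>i=1..N. ip (\<Sum>b\<in>B. representation B (F i) b \<odot> b) (G i))"
    by (simp add: ip_sum_left ip_scale_left mult.commute)
  also have "\<dots> = (\<Sum>i=1..N. ip (F i) (G i))"
    using sum_representation_eq[OF B(1) _ finB order_refl] B(2) by simp
  finally show ?thesis .
qed

text \<open>
  Expanding \<open>K x\<close> in an orthogonal basis gives the coefficients \<open>\<langle>K x, e\<rangle> / \<langle>e, e\<rangle>\<close>, which equal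
  \<open>\<langle>x, K e / \<langle>e, e\<rangle>\<rangle>\<close> because \<open>K\<close> is self-adjoint. The diagonal values \<open>\<langle>K e, e\<rangle> / \<langle>e, e\<rangle>\<close>
  are nonnegative; their sum shows that the trace is nonnegative.
\<close>

lemma K_dual_pair_exists:
  assumes lin: "Vector_Spaces.linear scale scale K" and psd: "positive_semidefinite K"
    and "dim UNIV \<le> N"
  obtains F G where "K_dual_pair N K F G" "\<And>i. ip (F i) (G i) \<in> \<real>\<^sub>\<ge>\<^sub>0"
proof -
  have self_adj: "ip (K x) y = ip x (K y)" for x y
    using ip_adj[OF lin] psd by (simp add: positive_semidefinite_def)
  obtain E where E: "finite E" "card E = dim UNIV" "\<And>x. x = (\<Sum>e\<in>E. (ip x e / ip e e) \<odot> e)"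
    by (rule orthogonal_basis) (rule that)
  obtain h where h: "bij_betw h {1..card E} E"
    using ex_bij_betw_nat_finite_1[OF E(1)] by blast
  define F where "F i = (if i \<in> {1..card E} then h i else 0)" for i
  define G where "G i = inverse (ip (F i) (F i)) \<odot> K (F i)" for i
  \<comment> \<open>This includes the padding indices, where \<open>F i = 0\<close>: both sides vanish, as \<open>inverse 0 = 0\<close>.\<close>
  have ipG: "ip x (G i) = ip (K x) (F i) / ip (F i) (F i)" for x i
    by (simp add: G_def ip_scale_right self_adj divide_inverse)
  have "K x = (\<Sum>i=1..N. ip x (G i) \<odot> F i)" for x
  proof -
    have "(\<Sum>i=1..N. ip x (G i) \<odot> F i) = (\<Sum>i=1..card E. ip x (G i) \<odot> F i)"
      by (rule sum.mono_neutral_right) (use assms(3) E(2) in \<open>auto simp: F_def\<close>)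
    also have "\<dots> = (\<Sum>i=1..card E. (ip (K x) (h i) / ip (h i) (h i)) \<odot> h i)"
      by (simp add: ipG) (simp add: F_def)
    also have "\<dots> = (\<Sum>e\<in>E. (ip (K x) e / ip e e) \<odot> e)"
      by (rule sum.reindex_bij_betw[OF h])
    finally show ?thesis using E(3) by simp
  qed
  then have "K_dual_pair N K F G" by (simp add: K_dual_pair_iff)
  moreover have "ip (F i) (G i) \<in> \<real>\<^sub>\<ge>\<^sub>0" for i
    unfolding ipG
    using psd ip_nonneg[of "F i"] nonneg_Reals_divide_I by (simp add: positive_semidefinite_def)
  ultimately show thesis using that by blast
qed

section \<open>Levelling the diagonal\<close>

text \<open>
  Adding \<open>\<alpha> f\<^sub>2\<close> to \<open>f\<^sub>1\<close> is compensated by subtracting \<open>\<alpha>\<^sup>* g\<^sub>1\<close> from \<open>g\<^sub>2\<close>, where \<open>\<alpha>\<^sup>*\<close> is the conjugate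
  of \<open>\<alpha>\<close>, and it changes \<open>\<langle>f\<^sub>1, g\<^sub>1\<rangle>\<close> by \<open>\<alpha> \<langle>f\<^sub>2, g\<^sub>1\<rangle>\<close>; the other shear changes it by
  \<open>\<alpha> \<langle>f\<^sub>1, g\<^sub>2\<rangle>\<close>. So any value is reached if one of the off-diagonal products is nonzero. Some
  hypothesis such as the one below is necessary, since conjugation fixes scalar matrices.
\<close>

lemma two_term_levelling:
  assumes "ip f\<^sub>1 g\<^sub>1 \<noteq> ip f\<^sub>2 g\<^sub>2"
  obtains f\<^sub>1' g\<^sub>1' f\<^sub>2' g\<^sub>2' where
    "\<And>x. ip x g\<^sub>1' \<odot> f\<^sub>1' + ip x g\<^sub>2' \<odot> f\<^sub>2' = ip x g\<^sub>1 \<odot> f\<^sub>1 + ip x g\<^sub>2 \<odot> f\<^sub>2"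
    "ip f\<^sub>1' g\<^sub>1' = t"
proof -
  define a where "a = ip f\<^sub>1 g\<^sub>1"
  define u where "u = ip f\<^sub>1 g\<^sub>2"
  define v where "v = ip f\<^sub>2 g\<^sub>1"
  define d where "d = ip f\<^sub>2 g\<^sub>2 - a"
  have d: "d \<noteq> 0" using assms by (simp add: a_def d_def)
  consider "u \<noteq> 0" | "v \<noteq> 0" | "u = 0" "v = 0" by blast
  then show thesis
  proof cases
    case 1
    define \<alpha> where "\<alpha> = (t - a) / u"
    have "ip x (g\<^sub>1 + rc_cnj \<alpha> \<odot> g\<^sub>2) \<odot> f\<^sub>1 + ip x g\<^sub>2 \<odot> (f\<^sub>2 - \<alpha> \<odot> f\<^sub>1)
        = ip x g\<^sub>1 \<odot> f\<^sub>1 + ip x g\<^sub>2 \<odot> f\<^sub>2" for x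
      by (simp add: ip_linear_simps algebra_simps)
    moreover have "ip f\<^sub>1 (g\<^sub>1 + rc_cnj \<alpha> \<odot> g\<^sub>2) = t"
      using 1 by (simp add: ip_linear_simps \<alpha>_def a_def u_def)
    ultimately show thesis by (rule that)
  next
    case 2
    define \<alpha> where "\<alpha> = (t - a) / v"
    have "ip x g\<^sub>1 \<odot> (f\<^sub>1 + \<alpha> \<odot> f\<^sub>2) + ip x (g\<^sub>2 - rc_cnj \<alpha> \<odot> g\<^sub>1) \<odot> f\<^sub>2
        = ip x g\<^sub>1 \<odot> f\<^sub>1 + ip x g\<^sub>2 \<odot> f\<^sub>2" for x
      by (simp add: ip_linear_simps algebra_simps)
    moreover have "ip (f\<^sub>1 + \<alpha> \<odot> f\<^sub>2) g\<^sub>1 = t"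
      using 2 by (simp add: ip_linear_simps \<alpha>_def a_def v_def)
    ultimately show thesis by (rule that)
  next
    case 3
    \<comment> \<open>A preliminary shear with coefficient 1 keeps \<open>\<langle>f\<^sub>1, g\<^sub>1\<rangle>\<close> and creates the off-diagonal entry
      \<open>\<langle>f\<^sub>2 - f\<^sub>1, g\<^sub>1 + g\<^sub>2\<rangle> = d\<close>, which the second shear uses.\<close>
    define \<alpha> where "\<alpha> = (t - a) / d"
    have "ip x (g\<^sub>1 + g\<^sub>2) \<odot> (f\<^sub>1 + \<alpha> \<odot> (f\<^sub>2 - f\<^sub>1))
          + ip x (g\<^sub>2 - rc_cnj \<alpha> \<odot> (g\<^sub>1 + g\<^sub>2)) \<odot> (f\<^sub>2 - f\<^sub>1)
        = ip x g\<^sub>1 \<odot> f\<^sub>1 + ip x g\<^sub>2 \<odot> f\<^sub>2" for x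
      by (simp add: ip_linear_simps algebra_simps)
    moreover have "ip (f\<^sub>1 + \<alpha> \<odot> (f\<^sub>2 - f\<^sub>1)) (g\<^sub>1 + g\<^sub>2) = t"
    proof -
      have "ip (f\<^sub>1 + \<alpha> \<odot> (f\<^sub>2 - f\<^sub>1)) (g\<^sub>1 + g\<^sub>2) = a + u + \<alpha> * (v + (d + a) - a - u)"
        by (simp add: ip_linear_simps a_def u_def v_def d_def algebra_simps)
      then show ?thesis using 3 d by (simp add: \<alpha>_def)
    qed
    ultimately show thesis by (rule that)
  qed
qed

text \<open>
  By induction on the number of indices whose diagonal entry is not yet \<open>t\<close>. The trace is
  \<open>N t\<close>, so these entries have the mean \<open>t\<close> and cannot all be equal; hence two of them differ, and
  levelling one of them to \<open>t\<close> spoils no index that was already done.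
\<close>

lemma uniform_K_dual_pair:
  assumes "K_dual_pair N K F G" and tr: "op_trace K = of_nat N * t"
  shows "\<exists>F' G'. K_dual_pair N K F' G' \<and> (\<forall>i\<in>{1..N}. ip (F' i) (G' i) = t)"
  using assms(1)
proof (induction "card {i\<in>{1..N}. ip (F i) (G i) \<noteq> t}" arbitrary: F G rule: less_induct)
  case less
  let ?bad = "\<lambda>F G. {i\<in>{1..N}. ip (F i) (G i) \<noteq> t}"
  show ?case
  proof (cases "?bad F G = {}")
    case True
    then show ?thesis using less.prems by blast
  next
    case False
    then obtain i where i: "i \<in> {1..N}" "ip (F i) (G i) \<noteq> t" by blast
    have "\<exists>j\<in>?bad F G. ip (F j) (G j) \<noteq> ip (F i) (G i)"
    proof (rule ccontr)
      assume "\<not> ?thesis"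
      then have "(\<Sum>j\<in>{1..N}. ip (F j) (G j) - t) = (\<Sum>j\<in>?bad F G. ip (F i) (G i) - t)"
        by (intro sum.mono_neutral_cong_right) auto
      then have "of_nat (card (?bad F G)) * (ip (F i) (G i) - t) = 0"
        using op_trace_K_dual_pair[OF less.prems] tr by (simp add: sum_subtractf)
      moreover have "card (?bad F G) \<noteq> 0" using False by (subst card_0_eq) auto
      ultimately show False using i(2) by simp
    qed
    then obtain j where j: "j \<in> {1..N}" "ip (F j) (G j) \<noteq> t" "ip (F i) (G i) \<noteq> ip (F j) (G j)"
      by fastforce
    then have "i \<noteq> j" by auto
    obtain f\<^sub>1 g\<^sub>1 f\<^sub>2 g\<^sub>2 where lev:
      "\<And>x. ip x g\<^sub>1 \<odot> f\<^sub>1 + ip x g\<^sub>2 \<odot> f\<^sub>2 = ip x (G i) \<odot> F i + ip x (G j) \<odot> F j" "ip f\<^sub>1 g\<^sub>1 = t"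
      by (rule two_term_levelling[OF j(3), of t]) (rule that)
    define F' where "F' = F(i := f\<^sub>1, j := f\<^sub>2)"
    define G' where "G' = G(i := g\<^sub>1, j := g\<^sub>2)"
    have "(\<Sum>k=1..N. ip x (G' k) \<odot> F' k) = (\<Sum>k=1..N. ip x (G k) \<odot> F k)" for x
    proof -
      have split: "(\<Sum>k=1..N. w k) = (w i + w j) + (\<Sum>k\<in>{1..N} - {i} - {j}. w k)" for w :: "nat \<Rightarrow> 'v"
        using sum.remove[of "{1..N}" i w] sum.remove[of "{1..N} - {i}" j w] i(1) j(1) \<open>i \<noteq> j\<close>
        by (simp add: add.assoc)
      have "(\<Sum>k\<in>{1..N} - {i} - {j}. ip x (G' k) \<odot> F' k)
          = (\<Sum>k\<in>{1..N} - {i} - {j}. ip x (G k) \<odot> F k)"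
        by (rule sum.cong) (auto simp: F'_def G'_def)
      then show ?thesis
        unfolding split using lev(1) \<open>i \<noteq> j\<close> by (simp add: F'_def G'_def)
    qed
    then have pair: "K_dual_pair N K F' G'"
      using less.prems by (simp add: K_dual_pair_iff)
    have "?bad F' G' \<subset> ?bad F G"
      using i j \<open>i \<noteq> j\<close> lev(2) by (auto simp: F'_def G'_def split: if_splits)
    then have "card (?bad F' G') < card (?bad F G)"
      by (intro psubset_card_mono) auto
    then show ?thesis using less.hyps pair by blast
  qed
qed

end

section \<open>The minimum and its attainment\<close>

lemma rc_cnj_diff: "rc_cnj (x - y) = rc_cnj x - rc_cnj (y :: 'k :: rc_scalar)"
  using rc_cnj_add[of x "- y"] by (simp add: rc_cnj_minus)

text \<open>
  The equality case of the triangle inequality, from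
  \<open>\<Sum>\<^sub>i |z\<^sub>i - s|\<^sup>2 = \<Sum>\<^sub>i |z\<^sub>i|\<^sup>2 - card I * s\<^sup>2 \<le> 0\<close>.
\<close>

lemma sum_extremal_imp_const:
  fixes z :: "'i \<Rightarrow> 'k :: rc_scalar"
  assumes "finite I" and le: "\<And>i. i \<in> I \<Longrightarrow> norm (z i) \<le> s"
    and sum: "(\<Sum>i\<in>I. z i) = of_nat (card I) * of_real s" and "i \<in> I"
  shows "z i = of_real s"
proof -
  have cnj_sum: "rc_cnj (\<Sum>i\<in>I. z i) = (\<Sum>i\<in>I. rc_cnj (z i))"
    using \<open>finite I\<close> by (induction I rule: finite_induct) (simp_all add: rc_cnj_add)
  have real: "(\<Sum>i\<in>I. z i) = of_real (card I * s)"
    using sum by simp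
  have expand: "of_real ((norm (z i - of_real s))\<^sup>2)
      = of_real ((norm (z i))\<^sup>2) - of_real s * z i - of_real s * rc_cnj (z i) + of_real (s\<^sup>2)" for i
    unfolding mult_rc_cnj[symmetric]
    by (simp add: rc_cnj_diff power2_eq_square algebra_simps)
  have "(of_real (\<Sum>i\<in>I. (norm (z i - of_real s))\<^sup>2) :: 'k)
      = of_real (\<Sum>i\<in>I. (norm (z i))\<^sup>2) - of_real s * (\<Sum>i\<in>I. z i)
        - of_real s * rc_cnj (\<Sum>i\<in>I. z i) + of_nat (card I) * of_real (s\<^sup>2)"
    unfolding of_real_sum expand cnj_sum
    by (simp add: sum.distrib sum_subtractf sum_distrib_left)
  also have "\<dots> = of_real ((\<Sum>i\<in>I. (norm (z i))\<^sup>2) - card I * s\<^sup>2)"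
    unfolding real rc_cnj_of_real by (simp add: power2_eq_square algebra_simps)
  finally have "(\<Sum>i\<in>I. (norm (z i - of_real s))\<^sup>2) = (\<Sum>i\<in>I. (norm (z i))\<^sup>2) - card I * s\<^sup>2"
    by (simp only: of_real_eq_iff)
  also have "\<dots> \<le> 0"
    using sum_bounded_above[of I "\<lambda>i. (norm (z i))\<^sup>2" "s\<^sup>2"] le by (simp add: power_mono)
  finally have "(\<Sum>i\<in>I. (norm (z i - of_real s))\<^sup>2) = 0"
    by (intro antisym sum_nonneg) simp_all
  then show ?thesis
    using \<open>finite I\<close> \<open>i \<in> I\<close> by (simp add: sum_nonneg_eq_0_iff)
qed


theorem theorem3p8:
  fixes scale :: "'k :: rc_scalar \<Rightarrow> 'v :: ab_group_add \<Rightarrow> 'v"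
    and ip :: "'v \<Rightarrow> 'v \<Rightarrow> 'k"
    and K :: "'v \<Rightarrow> 'v"
    and n N :: nat
  assumes "fd_hilbert scale ip"
    and "vector_space.dim scale (UNIV :: 'v set) = n"
    and "n \<le> N" and "0 < N"
    and "Vector_Spaces.linear scale scale K"
    and "fd_hilbert.positive_semidefinite ip K"
  shows "of_real (fd_hilbert.r1_inf scale ip N K) = fd_hilbert.op_trace scale K / of_nat N
    \<and> (\<forall>F G. fd_hilbert.K_dual_pair scale ip N K F G \<longrightarrow>
          ((F, G) \<in> fd_hilbert.R1_set scale ip N K
            \<longleftrightarrow> fd_hilbert.one_uniform scale ip N K F G))"
proof -
  interpret fd_hilbert scale ip by fact
  obtain F\<^sub>0 G\<^sub>0 where FG0: "K_dual_pair N K F\<^sub>0 G\<^sub>0" "\<And>i. ip (F\<^sub>0 i) (G\<^sub>0 i) \<in> \<real>\<^sub>\<ge>\<^sub>0"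
    using K_dual_pair_exists assms by metis
  have "op_trace K \<in> \<real>\<^sub>\<ge>\<^sub>0"
  proof -
    have "(\<Sum>i\<in>I. ip (F\<^sub>0 i) (G\<^sub>0 i)) \<in> \<real>\<^sub>\<ge>\<^sub>0" for I
      by (induction I rule: infinite_finite_induct) (use FG0(2) in auto)
    then show ?thesis by (simp add: op_trace_K_dual_pair[OF FG0(1)])
  qed
  then obtain r where r: "op_trace K = of_real r" "r \<ge> 0"
    by (auto elim: nonneg_Reals_cases)
  define s where "s = r / N"
  have s0: "s \<ge> 0" using r by (simp add: s_def)
  have tr: "op_trace K = of_nat N * of_real s"
    using r \<open>0 < N\<close> by (simp add: s_def)
  have entry_le: "norm (ip (F i) (G i)) \<le> r1 N F G" if "i \<in> {1..N}" for F G i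
    unfolding r1_eq using that by (intro Max_ge) auto
  have lower: "s \<le> r1 N F G" if "K_dual_pair N K F G" for F G
  proof -
    have "N * s = norm (\<Sum>i=1..N. ip (F i) (G i))"
      unfolding op_trace_K_dual_pair[OF that, symmetric] tr using s0 by (simp add: norm_mult)
    also have "\<dots> \<le> N * r1 N F G"
      using sum_norm_le[of "{1..N}" "\<lambda>i. ip (F i) (G i)" "\<lambda>_. r1 N F G"] entry_le by simp
    finally show ?thesis using \<open>0 < N\<close> by simp
  qed
  have const: "r1 N F G = norm c" if "\<forall>i\<in>{1..N}. ip (F i) (G i) = c" for F G c
  proof -
    have "(\<lambda>i. norm (ip (F i) (G i))) ` {1..N} = {norm c}"
      using that \<open>0 < N\<close> by (auto intro!: image_eqI[of _ _ 1])
    then show ?thesis by (simp add: r1_eq)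
  qed
  obtain F\<^sub>1 G\<^sub>1 where FG1: "K_dual_pair N K F\<^sub>1 G\<^sub>1" "\<forall>i\<in>{1..N}. ip (F\<^sub>1 i) (G\<^sub>1 i) = of_real s"
    using uniform_K_dual_pair[OF FG0(1) tr] by blast
  have inf: "r1_inf N K = s"
    unfolding r1_inf_def
  proof (rule cInf_eq_minimum)
    have "r1 N F\<^sub>1 G\<^sub>1 = s" using const[OF FG1(2)] s0 by simp
    then show "s \<in> {r1 N F G |F G. K_dual_pair N K F G}" using FG1(1) by blast
  qed (use lower in blast)
  have "(F, G) \<in> R1_set N K \<longleftrightarrow> one_uniform N K F G" if FG: "K_dual_pair N K F G" for F G
  proof -
    have tr_FG: "(\<Sum>i=1..N. ip (F i) (G i)) = of_nat N * of_real s"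
      using op_trace_K_dual_pair[OF FG] tr by simp
    have "one_uniform N K F G" if "r1 N F G = s"
    proof -
      have "ip (F i) (G i) = of_real s" if "i \<in> {1..N}" for i
        using sum_extremal_imp_const[of "{1..N}" "\<lambda>i. ip (F i) (G i)" s i] entry_le
          tr_FG \<open>r1 N F G = s\<close> that by fastforce
      then show ?thesis using FG by (auto simp: one_uniform_def)
    qed
    moreover have "r1 N F G = s" if uniform: "one_uniform N K F G"
    proof -
      obtain c where c: "\<forall>i\<in>{1..N}. ip (F i) (G i) = c"
        using uniform by (auto simp: one_uniform_def)
      then have "c = of_real s" using tr_FG \<open>0 < N\<close> by simp
      then show ?thesis using const[OF c] s0 by simp
    qed
    ultimately show ?thesis using FG inf by (auto simp: R1_set_def)
  qed
  then show ?thesis using inf tr \<open>0 < N\<close> by simp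
qed

end
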